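(* Let $P$ be a vector space over $\mathbb{C}$ and $P_1$ a subspace of $P$. Let $s\ge1$ and $k\ge0$ be integers. Suppose that $\lambda_1,\lambda_2,\ldots,\lambda_s\in\mathbb{C}^*$ are pairwise distinct, and that $v_{i,j}\in P$ and $f_{i,j}(t)\in\mathbb{C}[t]$ with $\deg(f_{i,j}(t))=j$ for $i=1,\ldots,s$ and $j=0,1,\ldots,k$. If $$\sum_{i=1}^s\sum_{j=0}^k\lambda_i^mf_{i,j}(m)v_{i,j}\in P_1\quad\text{for all } m\in\mathbb{Z},$$ then $v_{i,j}\in P_1$ for all $i,j$.
   Context: $\mathbb{C}^*=\mathbb{C}\setminus\{0\}$. *)

theory Defs
  imports Complex_Main "HOL-Computational_Algebra.Polynomial"
begin

end

theory Submission
  imports Defs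
begin

text \<open>
  The sequence \<open>g(m) = \<Sum>\<^sub>i \<Sum>\<^sub>j \<lambda>\<^sub>i\<^sup>m f\<^sub>i\<^sub>j(m) v\<^sub>i\<^sub>j\<close> takes its values in the subspace, and so does
  \<open>g(m + 1) - \<mu> g(m)\<close> for every scalar \<open>\<mu>\<close>. This twisted difference sends a summand
  \<open>\<lambda>\<^sup>m p(m) v\<close> to \<open>\<lambda>\<^sup>m q(m) v\<close> with \<open>q(x) = \<lambda> p(x + 1) - \<mu> p(x)\<close>. If \<open>\<lambda> \<noteq> \<mu>\<close>, then \<open>q\<close> has the
  same degree as \<open>p\<close>; if \<open>\<lambda> = \<mu> \<noteq> 0\<close>, the leading terms cancel and, in characteristic \<open>0\<close>, the
  degree drops by exactly one, constants being sent to \<open>0\<close>. Taking for \<open>\<mu>\<close> one of the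
  \<open>\<lambda>\<^sub>i\<close> thus removes the single vector \<open>v\<^sub>i\<^sub>0\<close>, and leaves a sum of the same shape in all the
  others, so induction on the number of vectors applies. The removed vector is then recovered
  from \<open>g(0)\<close>, where its coefficient is a nonzero constant.

  The induction needs a separate bound \<open>n i\<close> on the degrees for each \<open>i\<close>, because a step shortens
  the range of \<open>j\<close> for one \<open>i\<close> only.
\<close>

definition twisted_diff :: "'a::comm_ring_1 \<Rightarrow> 'a \<Rightarrow> 'a poly \<Rightarrow> 'a poly" where
  "twisted_diff l \<mu> p = smult l (pcompose p [:1, 1:]) - smult \<mu> p"

lemma poly_twisted_diff:
  "poly (twisted_diff l \<mu> p) x = l * poly p (x + 1) - \<mu> * poly p x"
  by (simp add: twisted_diff_def poly_pcompose add.commute)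

lemma twisted_diff_degree_0:
  assumes "degree p = 0"
  shows "twisted_diff l l p = 0"
  using assms by (auto simp: twisted_diff_def pcompose_const elim!: degree_eq_zeroE)

text \<open>A translation preserves the leading term, so the leading coefficient of \<open>p\<close> is multiplied
  by \<open>l - \<mu>\<close>.\<close>

lemma degree_twisted_diff_distinct:
  fixes p :: "'a::idom poly"
  assumes "l \<noteq> \<mu>" and "p \<noteq> 0"
  shows "twisted_diff l \<mu> p \<noteq> 0 \<and> degree (twisted_diff l \<mu> p) = degree p"
proof -
  let ?q = "pcompose p [:1, 1:]"
  have deg: "degree ?q = degree p"
    by (simp add: degree_pcompose)
  have "coeff ?q (degree p) = lead_coeff p"
    using lead_coeff_comp[of "[:1, 1:]" p] deg by simp
  then have "coeff (twisted_diff l \<mu> p) (degree p) = (l - \<mu>) * lead_coeff p"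
    by (simp add: twisted_diff_def left_diff_distrib)
  then have "coeff (twisted_diff l \<mu> p) (degree p) \<noteq> 0"
    using assms by simp
  moreover have "degree (twisted_diff l \<mu> p) \<le> degree p"
    unfolding twisted_diff_def
    by (intro degree_diff_le order_trans[OF degree_smult_le]) (simp_all add: deg)
  ultimately show ?thesis
    by (metis coeff_0 le_antisym le_degree)
qed

text \<open>Writing \<open>p = a + x q\<close>, the difference \<open>p(x + 1) - p(x)\<close> equals
  \<open>x (q(x + 1) - q(x)) + q(x + 1)\<close>, which makes an induction on the degree possible.\<close>

lemma forward_difference_leading_term:
  fixes p :: "'a::idom poly"
  assumes "degree p \<le> Suc n"
  shows "degree (pcompose p [:1, 1:] - p) \<le> n
    \<and> coeff (pcompose p [:1, 1:] - p) n = of_nat (Suc n) * coeff p (Suc n)"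
  using assms
proof (induction n arbitrary: p)
  case 0
  obtain a q where p: "p = pCons a q"
    by (cases p)
  with 0 have "degree q = 0"
    by (simp split: if_splits)
  then obtain b where "q = [:b:]"
    by (elim degree_eq_zeroE)
  with p show ?case
    by (simp add: pcompose_pCons)
next
  case (Suc n)
  obtain a q where p: "p = pCons a q"
    by (cases p)
  with Suc.prems have q: "degree q \<le> Suc n"
    by (simp split: if_splits)
  let ?D = "pcompose q [:1, 1:] - q"
  have diff: "pcompose p [:1, 1:] - p = pCons 0 ?D + pcompose q [:1, 1:]"
    by (simp add: p pcompose_pCons algebra_simps)
  have IH: "degree ?D \<le> n" "coeff ?D n = of_nat (Suc n) * coeff q (Suc n)"
    using Suc.IH[OF q] by auto
  have "degree (pCons 0 ?D) \<le> Suc n"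
    using IH(1) by (meson degree_pCons_le le_trans Suc_le_mono)
  then have "degree (pCons 0 ?D + pcompose q [:1, 1:]) \<le> Suc n"
    using q by (intro degree_add_le) (simp_all add: degree_pcompose)
  moreover have "coeff (pcompose q [:1, 1:]) (Suc n) = coeff q (Suc n)"
  proof -
    have "coeff ?D (Suc n) = 0"
      using IH(1) by (intro coeff_eq_0) simp
    then show ?thesis
      by simp
  qed
  ultimately show ?case
    unfolding diff using IH(2) by (simp add: p algebra_simps)
qed

lemma degree_twisted_diff_same:
  fixes p :: "'a::field_char_0 poly"
  assumes "l \<noteq> 0" and deg: "degree p = Suc n"
  shows "twisted_diff l l p \<noteq> 0 \<and> degree (twisted_diff l l p) = n"
proof -
  let ?D = "pcompose p [:1, 1:] - p"
  have twist: "twisted_diff l l p = smult l ?D"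
    by (simp add: twisted_diff_def smult_diff_right)
  have "coeff p (Suc n) \<noteq> 0"
    using deg by (metis degree_0 leading_coeff_0_iff nat.distinct(1))
  then have "coeff ?D n \<noteq> 0" "degree ?D \<le> n"
    using forward_difference_leading_term[of p n] deg by (simp_all del: of_nat_Suc)
  then have "?D \<noteq> 0" "degree ?D = n"
    by (metis coeff_0, metis le_antisym le_degree)
  then show ?thesis
    using \<open>l \<noteq> 0\<close> by (simp add: twist)
qed

text \<open>The induction is on the number of vectors \<open>v i j\<close>, with \<open>lam i0\<close> in the role of \<open>\<mu>\<close>.
  Distinctness of the \<open>lam i\<close> keeps the degrees for \<open>i \<noteq> i0\<close>, and \<open>lam i0 \<noteq> 0\<close> makes them
  drop by no more than one for \<open>i = i0\<close>.\<close>

lemma exponential_polynomial_coefficients_mem: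
  fixes scale :: "'a::field_char_0 \<Rightarrow> 'p::ab_group_add \<Rightarrow> 'p"
    and lam :: "'i \<Rightarrow> 'a"
  assumes "vector_space scale" and sub: "module.subspace scale U"
    and fin: "finite I"
    and nz: "\<And>i. i \<in> I \<Longrightarrow> lam i \<noteq> 0" and inj: "inj_on lam I"
    and "\<And>i j. i \<in> I \<Longrightarrow> j < n i \<Longrightarrow> f i j \<noteq> 0 \<and> degree (f i j) = j"
    and "\<And>m. (\<Sum>i\<in>I. \<Sum>j<n i. scale (lam i ^ m * poly (f i j) (of_nat m)) (v i j)) \<in> U"
    and "i \<in> I" and "j < n i"
  shows "v i j \<in> U"
proof -
  interpret vector_space scale
    by fact
  show ?thesis
    using assms(6-9)
  proof (induction "\<Sum>i\<in>I. n i" arbitrary: n f v i j rule: less_induct)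
    case less
    note deg = less.prems(1) and mem = less.prems(2)
    define i0 where "i0 = i"
    have i0: "i0 \<in> I"
      using less.prems(3) by (simp add: i0_def)
    obtain N where N: "n i0 = Suc N"
      using less.prems(4) by (cases "n i0") (auto simp: i0_def)
    \<comment> \<open>For \<open>i0\<close> the index is shifted, so that the polynomials of the new family again have
      degree equal to their index after the drop by one.\<close>
    define n' where "n' = n(i0 := N)"
    define f' where
      "f' i j = twisted_diff (lam i) (lam i0) (f i (if i = i0 then Suc j else j))" for i j
    define v' where "v' i j = v i (if i = i0 then Suc j else j)" for i j
    let ?g = "\<lambda>m. \<Sum>i\<in>I. \<Sum>j<n i. scale (lam i ^ m * poly (f i j) (of_nat m)) (v i j)"
    have smaller: "sum n' I < sum n I"
      using fin i0 N by (intro sum_strict_mono_ex1) (auto simp: n'_def)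
    have deg': "f' i j \<noteq> 0 \<and> degree (f' i j) = j" if "i \<in> I" "j < n' i" for i j
    proof (cases "i = i0")
      case True
      then show ?thesis
        using that deg[of i0 "Suc j"] N nz[OF i0]
          degree_twisted_diff_same[of "lam i0" "f i0 (Suc j)" j]
        by (simp add: f'_def n'_def)
    next
      case False
      then have "lam i \<noteq> lam i0"
        using inj i0 that by (auto dest: inj_onD)
      then show ?thesis
        using that False deg[of i j] degree_twisted_diff_distinct[of "lam i" "lam i0" "f i j"]
        by (simp add: f'_def n'_def)
    qed
    have mem': "(\<Sum>i\<in>I. \<Sum>j<n' i. scale (lam i ^ m * poly (f' i j) (of_nat m)) (v' i j)) \<in> U"
      for m
    proof -
      let ?h = "\<lambda>i j. scale (lam i ^ m * poly (twisted_diff (lam i) (lam i0) (f i j)) (of_nat m))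
        (v i j)"
      have "scale (lam i ^ Suc m * poly p (of_nat (Suc m))) w
          - scale (lam i0) (scale (lam i ^ m * poly p (of_nat m)) w)
        = scale (lam i ^ m * poly (twisted_diff (lam i) (lam i0) p) (of_nat m)) w" for i p w
        by (simp add: poly_twisted_diff right_diff_distrib mult_ac add.commute
            flip: scale_left_diff_distrib)
      then have "?g (Suc m) - scale (lam i0) (?g m) = (\<Sum>i\<in>I. \<Sum>j<n i. ?h i j)"
        by (simp only: scale_sum_right flip: sum_subtractf)
      also have "\<dots> = (\<Sum>i\<in>I. \<Sum>j<n' i. scale (lam i ^ m * poly (f' i j) (of_nat m)) (v' i j))"
      proof (rule sum.cong[OF refl])
        fix i assume "i \<in> I"
        show "(\<Sum>j<n i. ?h i j) =
          (\<Sum>j<n' i. scale (lam i ^ m * poly (f' i j) (of_nat m)) (v' i j))"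
        proof (cases "i = i0")
          case True
          \<comment> \<open>The twisted difference kills the constant \<open>f i0 0\<close>.\<close>
          have "?h i0 0 = 0"
            using deg[OF i0, of 0] N by (simp add: twisted_diff_degree_0)
          then show ?thesis
            by (simp add: True N n'_def f'_def v'_def sum.lessThan_Suc_shift del: sum.lessThan_Suc)
        qed (simp add: n'_def f'_def v'_def)
      qed
      finally have "?g (Suc m) - scale (lam i0) (?g m) = \<dots>" .
      then show ?thesis
        using subspace_diff[OF sub mem[of "Suc m"] subspace_scale[OF sub mem[of m], of "lam i0"]]
        by (simp only:)
    qed
    have rest: "v' i j \<in> U" if "i \<in> I" "j < n' i" for i j
      using less.hyps[OF smaller deg' mem' that] .
    have others: "v i j \<in> U" if "i \<in> I" "j < n i" "(i, j) \<noteq> (i0, 0)" for i j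
    proof (cases "i = i0")
      case True
      with that(3) obtain j' where "j = Suc j'"
        by (cases j) auto
      then show ?thesis
        using rest[of i0 j'] that True N by (simp add: v'_def n'_def)
    next
      case False
      then show ?thesis
        using rest[of i j] that by (simp add: v'_def n'_def)
    qed
    have "v i0 0 \<in> U"
    proof -
      \<comment> \<open>At \<open>m = 0\<close> all powers are \<open>1\<close>, and \<open>?r\<close> collects the terms already known to
        lie in \<open>U\<close>.\<close>
      let ?t = "\<lambda>i j. scale (poly (f i j) 0) (v i j)"
      let ?r = "(\<Sum>j<N. ?t i0 (Suc j)) + (\<Sum>i\<in>I - {i0}. \<Sum>j<n i. ?t i j)"
      have "?g 0 = ?t i0 0 + ?r"
        unfolding sum.remove[OF fin i0] N sum.lessThan_Suc_shift by (simp add: add.assoc)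
      moreover have "?r \<in> U"
        by (intro subspace_add[OF sub] subspace_sum[OF sub] subspace_scale[OF sub] others)
          (use i0 N in auto)
      ultimately have "?t i0 0 \<in> U"
        using subspace_diff[OF sub mem[of 0], of ?r] by (simp only: add_diff_cancel_right')
      moreover have "poly (f i0 0) 0 \<noteq> 0"
        using deg[OF i0, of 0] N by (auto elim!: degree_eq_zeroE)
      ultimately show ?thesis
        using subspace_scale[OF sub, of "?t i0 0" "inverse (poly (f i0 0) 0)"] by simp
    qed
    then show ?case
      using others less.prems(3,4) by (cases "(i, j) = (i0, 0)") auto
  qed
qed

theorem proposition5:
  fixes scale :: "complex \<Rightarrow> 'p::ab_group_add \<Rightarrow> 'p"
    and P1 :: "'p set"
    and s k :: nat
    and lam :: "nat \<Rightarrow> complex"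
    and v :: "nat \<Rightarrow> nat \<Rightarrow> 'p"
    and f :: "nat \<Rightarrow> nat \<Rightarrow> complex poly"
  assumes "vector_space scale"
    and "module.subspace scale P1"
    and "s \<ge> 1"
    and "\<And>i. i \<in> {1..s} \<Longrightarrow> lam i \<noteq> 0"
    and "inj_on lam {1..s}"
    and "\<And>i j. i \<in> {1..s} \<Longrightarrow> j \<in> {0..k} \<Longrightarrow> f i j \<noteq> 0 \<and> degree (f i j) = j"
    and "\<And>m::int. (\<Sum>i=1..s. \<Sum>j=0..k.
           scale (lam i powi m * poly (f i j) (of_int m)) (v i j)) \<in> P1"
  shows "\<forall>i\<in>{1..s}. \<forall>j\<in>{0..k}. v i j \<in> P1"
proof (intro ballI)
  fix i j assume ij: "i \<in> {1..s}" "j \<in> {0..k}"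
  have "(\<Sum>i\<in>{1..s}. \<Sum>j<Suc k. scale (lam i ^ m * poly (f i j) (of_nat m)) (v i j)) \<in> P1" for m
    using assms(7)[of "int m"]
    by (simp add: atLeast0AtMost lessThan_Suc_atMost del: sum.lessThan_Suc)
  then show "v i j \<in> P1"
    using ij exponential_polynomial_coefficients_mem[OF assms(1,2) finite_atLeastAtMost assms(4,5),
        where n = "\<lambda>_. Suc k" and f = f and v = v] assms(6)
    by (simp del: sum.lessThan_Suc)
qed

end
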